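(* Let $n\ge 1$, let $X$ be either $\mathbb{C}^n$ with $R=\mathbb{C}[x_1,\dots,x_n]$ or $(\mathbb{C}\setminus\{0\})^n$ with $R=\mathbb{C}[x_1^{\pm1},\dots,x_n^{\pm1}]$, and let $H=(h_1,\dots,h_n)^\top: X\times\mathbb{C}\to\mathbb{C}^n$ be a homotopy with $h_i\in R[t]$. Let $x(t)=(x_1(t),\dots,x_n(t))^\top\in\mathbb{C}[[t]]^n$ be a power series solution of $H$, i.e. $H(x(t),t)=0$ and $$x_j(t)=a_jt^{\omega_j}\Big(1+\sum_{\ell=1}^\infty a_{j\ell}t^\ell\Big),\quad j=1,\dots,n,$$ with $a_j\in\mathbb{C}\setminus\{0\}$, $\omega_j\in\mathbb{Z}_{\ge 0}$, $a_{j\ell}\in\mathbb{C}$, the series converging for all sufficiently small nonzero $|t|$. Let $x^{(0)}(t)\in\mathbb{C}[[t]]^n$, let $w_k$ ($k\ge 0$) be positive integers, and let $\{x^{(k)}(t)\}_{k\ge0}$ be the sequence in $\mathbb{C}[[t]]^n$ generated from $x^{(0)}(t)$ by $$\tilde{x}^{(k+1)}(t)=x^{(k)}(t)-J_H(x^{(k)}(t),t)^{-1}H(x^{(k)}(t),t)=\sum_{\ell=0}^\infty b_\ell t^\ell,\qquad x^{(k+1)}(t)=\sum_{\ell=0}^{w_k-1}b_\ell t^\ell,$$ where $b_\ell\in\mathbb{C}^n$ depends on $k$. If $J_H(x^{(k)}(t),t)$ is a unit in $\mathbb{C}[[t]]^{n\times n}$ for all $k\ge0$, then $$\operatorname{ord}(x^{(k+1)}(t)-x(t))\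 \ge\ \min\big(2\operatorname{ord}(x^{(k)}(t)-x(t)),\,w_k\big)\qquad\text{for all }k\ge0.$$
   Context: $J_H(x,t)=\left(\frac{\partial h_i}{\partial x_j}\right)_{i,j=1,\dots,n}$ is the Jacobian matrix of $H$ with respect to the variables $x_1,\dots,x_n$ only (not $t$). $\mathbb{C}[[t]]$ is the ring of formal power series. For $y(t)\in\mathbb{C}[[t]]^n$, $H(y(t),t)\in\mathbb{C}[[t]]^n$ and $J_H(y(t),t)\in\mathbb{C}[[t]]^{n\times n}$ denote the results of substituting $y(t)$ for $x$. In the Laurent polynomial case it is understood that the substitutions being made are well defined in $\mathbb{C}[[t]]$, i.e. for each variable $x_j$ occurring with a negative exponent in $H$, the $j$-th coordinate of the substituted series has nonzero constant term. A matrix in $\mathbb{C}[[t]]^{n\times n}$ is a unit if and only if its constant term (its value at $t=0$) is an invertible complex matrix. For a nonzero $v=\sum_{\ell\ge0}v_\ell t^\ell$ with coefficients $v_\ell\in\mathbb{C}^n$ (identifying $\mathbb{C}[[t]]^n$ with $\mathbb{C}^n[[t]]$), the order is $\operatorname{ord}(v)=\min\{\ell : v_\ell\ne0\}$; and $\operatorname{ord}(0)=\infty$ (with $2\cdot\infty=\infty$). *)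

theory Defs
  imports "HOL-Analysis.Analysis" "HOL-Library.Poly_Mapping"
begin

text \<open>The keys of a Laurent polynomial are exponent vectors; the ring structure of
  \<^typ>\<open>(int ^ 'n) \<Rightarrow>\<^sub>0 complex\<close> is the convolution product of the library, so this is
  $\mathbb{C}[x_1^{\pm 1}, \dots, x_n^{\pm 1}]$ with $n$ the cardinality of the index type.\<close>

type_synonym 'n laurent = "(int ^ 'n) \<Rightarrow>\<^sub>0 complex"

text \<open>$\mathbb{C}[x_1, \dots, x_n]$ as a subset of the Laurent polynomials.\<close>

definition polynomials :: "'n::finite laurent set" where
  "polynomials = {f. \<forall>m \<in> Poly_Mapping.keys f. \<forall>j. 0 \<le> m $ j}"

definition torus :: "(complex ^ 'n::finite) set" where
  "torus = {z. \<forall>j. z $ j \<noteq> 0}"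

text \<open>A homotopy is given by its components $h_i \in R[t]$; the variable of
  \<^typ>\<open>'n laurent poly\<close> is $t$, and the space $X$ matters only in that it
  determines $R$: no restriction on coefficients on the torus.\<close>

definition homotopy_on ::
    "(complex ^ 'n::finite) set \<Rightarrow> 'n laurent poly ^ 'n \<Rightarrow> bool" where
  "homotopy_on X H \<longleftrightarrow>
     X = UNIV \<and> (\<forall>i d. coeff (H $ i) d \<in> polynomials) \<or>
     X = torus"

text \<open>Substitution of power series for the variables $x_j$. The inverse of a power series with zero
  constant term is $0$ by library convention, so for negative exponents this is meaningful only
  under the condition \<open>substitutable\<close> below.\<close>

definition laurent_subst :: "complex fps ^ 'n::finite \<Rightarrow> 'n laurent \<Rightarrow> complex fps" where
  "laurent_subst y f =
     (\<Sum>m\<in>Poly_Mapping.keys f.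
        fps_const (Poly_Mapping.lookup f m) * (\<Prod>j\<in>UNIV. (y $ j) powi (m $ j)))"

definition series_subst :: "complex fps ^ 'n::finite \<Rightarrow> 'n laurent poly \<Rightarrow> complex fps" where
  "series_subst y h = poly (map_poly (laurent_subst y) h) fps_X"

definition subst_vec ::
    "'n::finite laurent poly ^ 'n \<Rightarrow> complex fps ^ 'n \<Rightarrow> complex fps ^ 'n" where
  "subst_vec H y = (\<chi> i. series_subst y (H $ i))"

definition subst_mat ::
    "'n::finite laurent poly ^ 'n ^ 'n \<Rightarrow> complex fps ^ 'n \<Rightarrow> complex fps ^ 'n ^ 'n" where
  "subst_mat A y = (\<chi> i j. series_subst y (A $ i $ j))"

definition occurs_negatively :: "'n::finite laurent poly ^ 'n \<Rightarrow> 'n \<Rightarrow> bool" where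
  "occurs_negatively H j \<longleftrightarrow>
     (\<exists>i d. \<exists>m \<in> Poly_Mapping.keys (coeff (H $ i) d). m $ j < 0)"

definition substitutable ::
    "'n::finite laurent poly ^ 'n \<Rightarrow> complex fps ^ 'n \<Rightarrow> bool" where
  "substitutable H y \<longleftrightarrow> (\<forall>j. occurs_negatively H j \<longrightarrow> fps_nth (y $ j) 0 \<noteq> 0)"

definition laurent_partial :: "'n::finite \<Rightarrow> 'n laurent \<Rightarrow> 'n laurent" where
  "laurent_partial j f =
     (\<Sum>m\<in>Poly_Mapping.keys f.
        Poly_Mapping.single (m - axis j 1) (of_int (m $ j) * Poly_Mapping.lookup f m))"

text \<open>Derivatives are taken in the $x_j$ only, hence coefficientwise in $t$.\<close>

definition x_jacobian :: "'n::finite laurent poly ^ 'n \<Rightarrow> 'n laurent poly ^ 'n ^ 'n" where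
  "x_jacobian H = (\<chi> i j. map_poly (laurent_partial j) (H $ i))"

definition newton_step ::
    "'n::finite laurent poly ^ 'n \<Rightarrow> complex fps ^ 'n \<Rightarrow> complex fps ^ 'n" where
  "newton_step H y = y - matrix_inv (subst_mat (x_jacobian H) y) *v subst_vec H y"

definition truncate :: "nat \<Rightarrow> complex fps ^ 'n::finite \<Rightarrow> complex fps ^ 'n" where
  "truncate w v = (\<chi> j. fps_cutoff w (v $ j))"

definition vec_coeff :: "complex fps ^ 'n::finite \<Rightarrow> nat \<Rightarrow> complex ^ 'n" where
  "vec_coeff v l = (\<chi> j. fps_nth (v $ j) l)"

definition vec_order :: "complex fps ^ 'n::finite \<Rightarrow> enat" where
  "vec_order v = (if v = 0 then \<infinity> else enat (LEAST l. vec_coeff v l \<noteq> 0))"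

definition power_series_solution ::
    "'n::finite laurent poly ^ 'n \<Rightarrow> complex fps ^ 'n \<Rightarrow> bool" where
  "power_series_solution H x \<longleftrightarrow>
     substitutable H x \<and> subst_vec H x = 0 \<and>
     (\<forall>j. \<exists>a \<omega> c. a \<noteq> 0 \<and>
        x $ j = fps_const a * fps_X ^ \<omega> * (1 + Abs_fps (\<lambda>l. if l = 0 then 0 else c l))) \<and>
     (\<forall>j. \<forall>\<^sub>F t in at 0. summable (\<lambda>l. fps_nth (x $ j) l * t ^ l))"

end

theory Submission
  imports Defs
begin

text \<open>The second-order Taylor remainder of a Laurent monomial is divisible by $q^2$ whenever
  $q$ divides every increment, and this passes to $H$ by linearity. With $H(x(t),t) = 0$ it says
  that the error of a Newton step is the inverse Jacobian applied to such a remainder, taken with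
  $q = t^N$ and $N$ the order of the current error; truncation at $w$ only affects the
  coefficients from $t^w$ on.\<close>

section \<open>First-order expansion of products, powers and inverses modulo
  \<open>q ^ 2\<close>\<close>

text \<open>The Leibniz rule modulo \<open>q ^ 2\<close>: every term containing two increments
  vanishes. The increments \<open>d\<close> need only approximate \<open>a - b\<close> modulo
  \<open>q ^ 2\<close>, so that factors which are themselves expanded to first order can be fed in.
  The second conjunct strengthens the induction.\<close>

lemma prod_first_order_cong:
  fixes a b d :: "'i \<Rightarrow> 'a::comm_ring_1"
  assumes "finite I"
    and "\<And>i. i \<in> I \<Longrightarrow> q ^ 2 dvd a i - b i - d i"
    and "\<And>i. i \<in> I \<Longrightarrow> q dvd d i"
  shows "q ^ 2 dvd (\<Prod>i\<in>I. a i) - (\<Prod>i\<in>I. b i) - (\<Sum>i\<in>I. d i * (\<Prod>k\<in>I - {i}. b k))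
    \<and> q dvd (\<Sum>i\<in>I. d i * (\<Prod>k\<in>I - {i}. b k))"
  using assms
proof (induction I rule: finite_induct)
  case empty
  then show ?case by simp
next
  case (insert j I)
  define A B S where "A = (\<Prod>i\<in>I. a i)" and "B = (\<Prod>i\<in>I. b i)"
    and "S = (\<Sum>i\<in>I. d i * (\<Prod>k\<in>I - {i}. b k))"
  have IH: "q ^ 2 dvd A - B - S" "q dvd S"
    using insert by (auto simp: A_def B_def S_def)
  have j: "q ^ 2 dvd a j - b j - d j" "q dvd d j"
    using insert.prems by auto
  have "(\<Sum>i\<in>I. d i * (\<Prod>k\<in>insert j I - {i}. b k)) = (\<Sum>i\<in>I. d i * (b j * (\<Prod>k\<in>I - {i}. b k)))"
  proof (rule sum.cong)
    fix i assume "i \<in> I"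
    then have "insert j I - {i} = insert j (I - {i})" using insert.hyps by auto
    then show "d i * (\<Prod>k\<in>insert j I - {i}. b k) = d i * (b j * (\<Prod>k\<in>I - {i}. b k))"
      using insert.hyps by simp
  qed simp
  then have S': "(\<Sum>i\<in>insert j I. d i * (\<Prod>k\<in>insert j I - {i}. b k)) = d j * B + b j * S"
    using insert.hyps by (simp add: B_def S_def sum_distrib_left mult_ac)
  \<comment> \<open>The first two summands are remainders already controlled; the only new error is
    \<open>d j * S\<close>, a product of two multiples of \<open>q\<close>.\<close>
  have "a j * A - b j * B - (d j * B + b j * S)
      = (a j - b j - d j) * A + (b j + d j) * (A - B - S) + d j * S"
    by (simp add: algebra_simps)
  moreover have "q ^ 2 dvd d j * S"
    using mult_dvd_mono[OF j(2) IH(2)] by (simp add: power2_eq_square)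
  ultimately have "q ^ 2 dvd a j * A - b j * B - (d j * B + b j * S)"
    using j IH by simp
  then show ?case
    unfolding S' using insert.hyps j(2) IH(2) by (simp add: A_def B_def)
qed

lemma power_first_order_cong:
  fixes x y d :: "'a::comm_ring_1"
  assumes "q ^ 2 dvd x - y - d" "q dvd d"
  shows "q ^ 2 dvd x ^ n - y ^ n - of_nat n * y ^ (n - 1) * d"
proof -
  \<comment> \<open>For \<open>n = 0\<close> the truncated exponent is harmless, since both sides
    vanish.\<close>
  have "(\<Sum>i<n. d * (\<Prod>k\<in>{..<n} - {i}. y)) = of_nat n * y ^ (n - 1) * d"
    by (simp add: mult_ac)
  then show ?thesis
    using prod_first_order_cong[of "{..<n}" q "\<lambda>_. x" "\<lambda>_. y" "\<lambda>_. d"] assms by (simp add: mult_ac)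
qed

text \<open>Nonzero constant terms make \<open>inverse\<close> a genuine inverse, and the remainder
  is then exactly \<open>inverse x * inverse y ^ 2 * (x - y) ^ 2\<close>.\<close>

lemma fps_inverse_first_order_cong:
  fixes x y :: "'a::field fps"
  assumes "fps_nth x 0 \<noteq> 0" "fps_nth y 0 \<noteq> 0" "q dvd x - y"
  shows "q ^ 2 dvd inverse x - inverse y - (- (inverse y ^ 2 * (x - y)))"
proof -
  have x: "inverse x * x = 1" and y: "inverse y * y = 1"
    using assms by (simp_all add: inverse_mult_eq_1)
  have "inverse x - inverse y - (- (inverse y ^ 2 * (x - y)))
      = inverse x * inverse y ^ 2 * (x - y) ^ 2"
    using x y by algebra
  then show ?thesis using assms(3) by (simp add: dvd_power_same)
qed

text \<open>A negative power is a natural power of the inverse, so the two preceding congruences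
  combine as in the chain rule. Units are required only in that case.\<close>

lemma fps_power_int_first_order_cong:
  fixes x y :: "'a::field fps"
  assumes dvd: "q dvd x - y"
    and unit: "m < 0 \<Longrightarrow> fps_nth x 0 \<noteq> 0 \<and> fps_nth y 0 \<noteq> 0"
  shows "q ^ 2 dvd x powi m - y powi m - of_int m * y powi (m - 1) * (x - y)"
proof (cases "m < 0")
  case False
  \<comment> \<open>At \<open>m = 0\<close> the exponents differ, -1 on the left and 0 on the right,
    but both are multiplied by zero.\<close>
  have "of_int m * y powi (m - 1) = of_nat (nat m) * y ^ (nat m - 1)"
  proof (cases "m = 0")
    case False
    with \<open>\<not> m < 0\<close> have "nat (m - 1) = nat m - 1" "m - 1 \<ge> 0" by auto
    then show ?thesis using \<open>\<not> m < 0\<close> by (simp add: power_int_def)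
  qed simp
  moreover have "x powi m = x ^ nat m" "y powi m = y ^ nat m"
    using False by (simp_all add: power_int_def)
  ultimately show ?thesis
    using power_first_order_cong[of q x y "x - y" "nat m"] dvd by simp
next
  case True
  define n where "n = nat (- m)"
  have n: "n > 0" "of_int m = - (of_nat n :: 'a fps)" using True by (simp_all add: n_def)
  have m1: "nat (- (m - 1)) = n + 1" using True by (simp add: n_def)
  have pow: "x powi m = inverse x ^ n" "y powi m = inverse y ^ n"
    "y powi (m - 1) = inverse y ^ (n + 1)"
    using True m1 by (simp_all add: power_int_def n_def)
  \<comment> \<open>The linear part of \<open>inverse x - inverse y\<close>, which serves as the
    approximate increment for the power congruence.\<close>
  let ?d = "- (inverse y ^ 2 * (x - y))"
  have "q ^ 2 dvd inverse x ^ n - inverse y ^ n - of_nat n * inverse y ^ (n - 1) * ?d"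
    by (rule power_first_order_cong)
      (use fps_inverse_first_order_cong[of x y q] unit[OF True] dvd in simp_all)
  moreover have "inverse y ^ (n + 1) = inverse y ^ (n - 1) * inverse y ^ 2"
    using n(1) by (simp flip: power_add)
  then have "of_int m * y powi (m - 1) * (x - y) = of_nat n * inverse y ^ (n - 1) * ?d"
    unfolding pow n(2) by (simp add: mult_ac)
  ultimately show ?thesis by (simp only: pow)
qed

section \<open>Substitution into Laurent polynomials and its Taylor expansion\<close>

text \<open>Allows several polynomials to be summed over one common set of exponents, as additivity
  requires.\<close>

lemma laurent_subst_alt:
  assumes "finite A" "Poly_Mapping.keys f \<subseteq> A"
  shows "laurent_subst y f =
    (\<Sum>m\<in>A. fps_const (Poly_Mapping.lookup f m) * (\<Prod>j\<in>UNIV. (y $ j) powi (m $ j)))"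
  unfolding laurent_subst_def
  by (rule sum.mono_neutral_left) (use assms in \<open>auto simp: in_keys_iff\<close>)

lemma laurent_subst_0 [simp]: "laurent_subst y 0 = 0"
  by (simp add: laurent_subst_def)

lemma laurent_subst_add: "laurent_subst y (f + g) = laurent_subst y f + laurent_subst y g"
proof -
  let ?A = "Poly_Mapping.keys f \<union> Poly_Mapping.keys g"
  have "Poly_Mapping.keys (f + g) \<subseteq> ?A" by (rule Poly_Mapping.keys_add)
  then show ?thesis
    by (simp add: laurent_subst_alt[of ?A] lookup_add sum.distrib distrib_right
        flip: fps_const_add)
qed

lemma laurent_subst_sum: "laurent_subst y (sum f A) = (\<Sum>a\<in>A. laurent_subst y (f a))"
  by (induction A rule: infinite_finite_induct) (simp_all add: laurent_subst_add)

lemma laurent_subst_single: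
  "laurent_subst y (Poly_Mapping.single m c) = fps_const c * (\<Prod>j\<in>UNIV. (y $ j) powi (m $ j))"
  by (subst laurent_subst_alt[of "{m}"]) auto

lemma laurent_monomial_taylor:
  fixes x y :: "'a::field fps ^ 'n::finite"
  assumes dvd: "\<And>j. q dvd x $ j - y $ j"
    and unit: "\<And>j. m $ j < 0 \<Longrightarrow> fps_nth (x $ j) 0 \<noteq> 0 \<and> fps_nth (y $ j) 0 \<noteq> 0"
  shows "q ^ 2 dvd (\<Prod>j\<in>UNIV. (x $ j) powi (m $ j)) - (\<Prod>j\<in>UNIV. (y $ j) powi (m $ j)) -
    (\<Sum>j\<in>UNIV. of_int (m $ j) * (\<Prod>k\<in>UNIV. (y $ k) powi ((m - axis j 1) $ k)) * (x $ j - y $ j))"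
proof -
  define d where "d j = of_int (m $ j) * (y $ j) powi (m $ j - 1) * (x $ j - y $ j)" for j
  \<comment> \<open>Only the factor at \<open>j\<close> sees the shift by \<open>axis j 1\<close>,
    so the Leibniz term is the partial derivative of the monomial times its increment.\<close>
  have "d j * (\<Prod>k\<in>UNIV - {j}. (y $ k) powi (m $ k))
      = of_int (m $ j) * (\<Prod>k\<in>UNIV. (y $ k) powi ((m - axis j 1) $ k)) * (x $ j - y $ j)" for j
  proof -
    have "(\<Prod>k\<in>UNIV. (y $ k) powi ((m - axis j 1) $ k))
        = (y $ j) powi (m $ j - 1) * (\<Prod>k\<in>UNIV - {j}. (y $ k) powi ((m - axis j 1) $ k))"
      by (subst prod.remove[of _ j]) (simp_all add: axis_def)
    also have "(\<Prod>k\<in>UNIV - {j}. (y $ k) powi ((m - axis j 1) $ k))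
        = (\<Prod>k\<in>UNIV - {j}. (y $ k) powi (m $ k))"
      by (rule prod.cong) (auto simp: axis_def)
    finally show ?thesis by (simp add: d_def mult_ac)
  qed
  moreover have "q ^ 2 dvd (x $ j) powi (m $ j) - (y $ j) powi (m $ j) - d j" "q dvd d j" for j
    unfolding d_def using dvd unit by (auto intro: fps_power_int_first_order_cong)
  ultimately show ?thesis
    using prod_first_order_cong[of UNIV q "\<lambda>j. (x $ j) powi (m $ j)" "\<lambda>j. (y $ j) powi (m $ j)" d]
    by simp
qed

lemma laurent_taylor:
  assumes dvd: "\<And>j. q dvd x $ j - y $ j"
    and unit: "\<And>m j. m \<in> Poly_Mapping.keys f \<Longrightarrow> m $ j < 0 \<Longrightarrow>
      fps_nth (x $ j) 0 \<noteq> 0 \<and> fps_nth (y $ j) 0 \<noteq> 0"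
  shows "q ^ 2 dvd laurent_subst x f - laurent_subst y f -
    (\<Sum>j\<in>UNIV. laurent_subst y (laurent_partial j f) * (x $ j - y $ j))"
proof -
  let ?P = "\<lambda>z m. \<Prod>k\<in>UNIV. (z $ k) powi (m $ k)"
  let ?c = "\<lambda>m. fps_const (Poly_Mapping.lookup f m)"
  have const: "fps_const (of_int i * c) = of_int i * fps_const c" for i and c :: complex
    by (simp add: fps_of_int[symmetric])
  \<comment> \<open>Everything is linear in \<open>f\<close>: after interchanging the sums over
    variables and exponents, the remainder of \<open>f\<close> is the combination of the monomial
    remainders.\<close>
  have "laurent_subst x f - laurent_subst y f -
      (\<Sum>j\<in>UNIV. laurent_subst y (laurent_partial j f) * (x $ j - y $ j))
    = (\<Sum>m\<in>Poly_Mapping.keys f. ?c m * (?P x m - ?P y m -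
        (\<Sum>j\<in>UNIV. of_int (m $ j) * ?P y (m - axis j 1) * (x $ j - y $ j))))"
    unfolding laurent_partial_def laurent_subst_sum laurent_subst_single const
    by (simp add: laurent_subst_def right_diff_distrib sum_subtractf sum_distrib_left
        sum_distrib_right mult_ac sum.swap[of _ "Poly_Mapping.keys f"])
  moreover have "q ^ 2 dvd \<dots>"
    using laurent_monomial_taylor[OF dvd] unit by (intro dvd_sum dvd_mult) blast
  ultimately show ?thesis by simp
qed

text \<open>The sum runs to the degree of \<open>p\<close> because \<open>f\<close> may kill leading
  coefficients. A polynomial and its derivatives thereby share one index range.\<close>

lemma poly_map_poly_altdef:
  fixes f :: "'a::zero \<Rightarrow> 'b::comm_semiring_1"
  assumes "f 0 = 0"
  shows "poly (map_poly f p) a = (\<Sum>i\<le>degree p. f (coeff p i) * a ^ i)"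
proof -
  have "poly (map_poly f p) a = (\<Sum>i\<le>degree (map_poly f p). coeff (map_poly f p) i * a ^ i)"
    by (rule poly_altdef)
  also have "\<dots> = (\<Sum>i\<le>degree p. coeff (map_poly f p) i * a ^ i)"
    by (rule sum.mono_neutral_left) (auto simp: map_poly_degree_leq coeff_eq_0)
  finally show ?thesis using assms by (simp add: coeff_map_poly)
qed

text \<open>Differentiation in the \<open>x\<close> variables treats \<open>t\<close> as a constant,
  so the Laurent expansion applies to each coefficient of \<open>t\<close>.\<close>

lemma series_taylor:
  assumes dvd: "\<And>j. q dvd x $ j - y $ j"
    and unit: "\<And>d m j. m \<in> Poly_Mapping.keys (coeff h d) \<Longrightarrow> m $ j < 0 \<Longrightarrow>
      fps_nth (x $ j) 0 \<noteq> 0 \<and> fps_nth (y $ j) 0 \<noteq> 0"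
  shows "q ^ 2 dvd series_subst x h - series_subst y h -
    (\<Sum>j\<in>UNIV. series_subst y (map_poly (laurent_partial j) h) * (x $ j - y $ j))"
proof -
  have p0: "laurent_partial j 0 = 0" for j :: 'a by (simp add: laurent_partial_def)
  define D where "D j d = laurent_subst y (laurent_partial j (coeff h d)) * (x $ j - y $ j)" for j d
  have "series_subst y (map_poly (laurent_partial j) h) * (x $ j - y $ j)
      = (\<Sum>d\<le>degree h. D j d * fps_X ^ d)" for j
    by (simp add: series_subst_def map_poly_map_poly p0 poly_map_poly_altdef sum_distrib_left
        D_def mult_ac)
  then have "(\<Sum>j\<in>UNIV. series_subst y (map_poly (laurent_partial j) h) * (x $ j - y $ j))
      = (\<Sum>d\<le>degree h. (\<Sum>j\<in>UNIV. D j d) * fps_X ^ d)"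
    by (simp add: sum_distrib_right sum.swap[of _ "{..degree h}"])
  then have "series_subst x h - series_subst y h -
      (\<Sum>j\<in>UNIV. series_subst y (map_poly (laurent_partial j) h) * (x $ j - y $ j))
    = (\<Sum>d\<le>degree h. (laurent_subst x (coeff h d) - laurent_subst y (coeff h d) -
        (\<Sum>j\<in>UNIV. D j d)) * fps_X ^ d)"
    by (simp add: series_subst_def poly_map_poly_altdef left_diff_distrib sum_subtractf)
  moreover have "q ^ 2 dvd \<dots>"
    unfolding D_def using laurent_taylor[OF dvd] unit by (intro dvd_sum dvd_mult2) blast
  ultimately show ?thesis by simp
qed

section \<open>The error of a Newton step\<close>

lemma matrix_inv_left:
  assumes "invertible A"
  shows "matrix_inv A ** A = mat 1"
  using someI_ex[OF assms[unfolded invertible_def]] by (simp add: matrix_inv_def)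

lemma newton_step_error_dvd:
  assumes sol: "subst_vec H x = 0" and "substitutable H x" "substitutable H y"
    and inv: "invertible (subst_mat (x_jacobian H) y)"
    and dvd: "\<And>j. q dvd y $ j - x $ j"
  shows "q ^ 2 dvd newton_step H y $ i - x $ i"
proof -
  let ?J = "subst_mat (x_jacobian H) y"
  \<comment> \<open>The Taylor remainder with expansion point \<open>y\<close>, the current iterate,
    evaluated at the solution \<open>x\<close>; thus the Jacobian that occurs is the one inverted by
    the step.\<close>
  define r where "r = subst_vec H x - subst_vec H y - ?J *v (x - y)"
  have r: "q ^ 2 dvd r $ k" for k
  proof -
    have "q ^ 2 dvd series_subst x (H $ k) - series_subst y (H $ k) -
      (\<Sum>j\<in>UNIV. series_subst y (map_poly (laurent_partial j) (H $ k)) * (x $ j - y $ j))"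
    proof (rule series_taylor)
      show "q dvd x $ j - y $ j" for j
        using dvd[of j] by (simp only: dvd_diff_commute)
      show "fps_nth (x $ j) 0 \<noteq> 0 \<and> fps_nth (y $ j) 0 \<noteq> 0"
        if "m \<in> Poly_Mapping.keys (coeff (H $ k) d)" "m $ j < 0" for d m j
        using assms(2,3) that unfolding substitutable_def occurs_negatively_def by blast
    qed
    then show ?thesis
      by (simp add: r_def subst_vec_def subst_mat_def x_jacobian_def matrix_vector_mult_def)
  qed
  \<comment> \<open>As \<open>subst_vec H x\<close> vanishes, applying the inverse to
    \<open>r\<close> leaves \<open>y - x\<close> minus the Newton correction.\<close>
  have "newton_step H y - x = matrix_inv ?J *v r"
  proof -
    have "matrix_inv ?J *v (?J *v (x - y)) = x - y"
      using matrix_inv_left[OF inv] by (simp add: matrix_vector_mul_assoc)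
    moreover have "matrix_inv ?J *v (- subst_vec H y) = - (matrix_inv ?J *v subst_vec H y)"
      using matrix_vector_mult_diff_distrib[of "matrix_inv ?J" 0 "subst_vec H y"] by simp
    ultimately show ?thesis
      by (simp add: newton_step_def r_def sol matrix_vector_mult_diff_distrib)
  qed
  then have "(newton_step H y - x) $ i = (\<Sum>k\<in>UNIV. matrix_inv ?J $ i $ k * r $ k)"
    by (simp only: matrix_vector_mult_def vec_lambda_beta)
  then show ?thesis using r by (simp add: dvd_sum)
qed

section \<open>Orders as divisibility by powers of the series variable\<close>

lemma fps_X_power_dvd_iff_nth:
  fixes f :: "'a::field fps"
  shows "fps_X ^ N dvd f \<longleftrightarrow> (\<forall>l<N. fps_nth f l = 0)"
proof
  assume "fps_X ^ N dvd f"
  then show "\<forall>l<N. fps_nth f l = 0" by (auto simp: dvd_def fps_X_power_mult_nth)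
next
  assume *: "\<forall>l<N. fps_nth f l = 0"
  have "f = fps_X ^ N * fps_shift N f"
    using * by (intro fps_ext) (auto simp: fps_X_power_mult_nth)
  then show "fps_X ^ N dvd f" by (metis dvd_triv_left)
qed

text \<open>Turns order bounds into the divisibility used for the Taylor remainders. The zero
  vector, of infinite order, satisfies both sides for every \<open>N\<close>.\<close>

lemma vec_order_ge_iff:
  "enat N \<le> vec_order v \<longleftrightarrow> (\<forall>j. fps_X ^ N dvd v $ j)"
proof (cases "v = 0")
  case True
  then show ?thesis by (simp add: vec_order_def)
next
  case False
  then have "\<exists>l. vec_coeff v l \<noteq> 0"
    by (auto simp: vec_coeff_def vec_eq_iff fps_eq_iff)
  then have "vec_coeff v (LEAST l. vec_coeff v l \<noteq> 0) \<noteq> 0" by (rule LeastI_ex)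
  then have "N \<le> (LEAST l. vec_coeff v l \<noteq> 0) \<longleftrightarrow> (\<forall>l<N. vec_coeff v l = 0)"
    using not_less_Least[of _ "\<lambda>l. vec_coeff v l \<noteq> 0"] by (meson not_less order_less_le_trans)
  then show ?thesis
    using False by (auto simp: vec_order_def fps_X_power_dvd_iff_nth vec_coeff_def vec_eq_iff)
qed

text \<open>Replaces an order that may be infinite by finite lower bounds \<open>N\<close>. A finite
  \<open>a\<close> is its own best bound.\<close>

lemma min_double_enat_le:
  assumes "\<And>N. enat N \<le> a \<Longrightarrow> enat (min (2 * N) w) \<le> b"
  shows "min (2 * a) (enat w) \<le> b"
proof (cases a)
  case (enat n)
  then have "min (2 * a) (enat w) = enat (min (2 * n) w)"
    by (simp add: min_def numeral_eq_enat)
  then show ?thesis using assms[of n] enat by simp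
next
  case infinity
  \<comment> \<open>The minimum is now \<open>w\<close>, and the bound \<open>N = w\<close> already
    yields it because \<open>2 * w\<close> is at least \<open>w\<close>.\<close>
  then show ?thesis using assms[of w] imult_infinity_right[of 2]
    by (cases "w = 0") (simp_all add: min_def)
qed

theorem theorem4p2:
  fixes X :: "(complex ^ 'n::finite) set"
    and H :: "'n laurent poly ^ 'n"
    and x :: "complex fps ^ 'n"
    and xs :: "nat \<Rightarrow> complex fps ^ 'n"
    and w :: "nat \<Rightarrow> nat"
  assumes "homotopy_on X H"
    and "power_series_solution H x"
    and "\<And>k. 0 < w k"
    and "\<And>k. substitutable H (xs k)"
    and "\<And>k. invertible (subst_mat (x_jacobian H) (xs k))"
    and "\<And>k. xs (Suc k) = truncate (w k) (newton_step H (xs k))"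
  shows "\<forall>k. vec_order (xs (Suc k) - x) \<ge> min (2 * vec_order (xs k - x)) (enat (w k))"
proof (intro allI min_double_enat_le)
  fix k N
  assume "enat N \<le> vec_order (xs k - x)"
  then have "fps_X ^ N dvd xs k $ j - x $ j" for j
    by (simp add: vec_order_ge_iff)
  moreover have "subst_vec H x = 0" "substitutable H x"
    using assms(2) by (simp_all add: power_series_solution_def)
  ultimately have "fps_X ^ (2 * N) dvd newton_step H (xs k) $ j - x $ j" for j
    using newton_step_error_dvd[of H x "xs k" "fps_X ^ N" j] assms(4,5)
    by (simp add: mult.commute flip: power_mult)
  \<comment> \<open>Below \<open>w k\<close> the cutoff keeps the coefficients of the Newton step,
    and below \<open>2 * N\<close> these agree with those of \<open>x\<close>.\<close>
  then show "enat (min (2 * N) (w k)) \<le> vec_order (xs (Suc k) - x)"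
    by (simp add: vec_order_ge_iff fps_X_power_dvd_iff_nth assms(6) truncate_def)
qed

end
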